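(* Let $L>0$ and let $p_1,p_2,\dots$ be independent random variables uniformly distributed on $(0,1)$. Start with a stick of length $L$ and cut it at proportion $p_1$, giving sticks of lengths $Lp_1$ and $L(1-p_1)$. Do not decompose the stick of length $L(1-p_1)$ further, but cut the other stick at proportion $p_2$, giving sticks of lengths $Lp_1p_2$ and $Lp_1(1-p_2)$; again the latter is not decomposed further. Repeating recursively so that $N-1$ cuts are made in total leaves $N$ sticks $$X_1=L(1-p_1),\quad X_2=Lp_1(1-p_2),\ \dots,\ X_{N-1}=Lp_1p_2\cdots p_{N-2}(1-p_{N-1}),\quad X_N=Lp_1p_2\cdots p_{N-1}.$$ Then, as $N\to\infty$, the distribution of the leading digits of these $N$ sticks converges in distribution to Benford's Law; that is, with $P_N(s)=\frac1N\sum_{i=1}^N\varphi_s(X_i)$, for every $s\in[1,10)$ one has $\lim_{N\to\infty}\mathbb{E}[P_N(s)]=\log_{10}s$ and $\lim_{N\to\infty}\mathrm{Var}(P_N(s))=0$.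
   Context: Every $x>0$ is written uniquely as $x=S_{10}(x)\cdot 10^{k}$ with $k\in\mathbb{Z}$ and significand $S_{10}(x)\in[1,10)$. For $s\in[1,10)$, $\varphi_s(x)=1$ if $S_{10}(x)\le s$ and $\varphi_s(x)=0$ otherwise. Convergence in distribution of a random finite collection of lengths to Benford's Law is understood in the sense that the proportion $P_N(s)$ of lengths with significand at most $s$ has mean tending to $\log_{10}s$ and variance tending to $0$, for every $s\in[1,10)$. *)

theory Defs
  imports "HOL-Probability.Probability"
begin

lemma significand_ex1:
  fixes x :: real
  assumes "x > 0"
  shows "\<exists>!s. 1 \<le> s \<and> s < 10 \<and> (\<exists>k::int. x = s * 10 powi k)"
proof (rule ex_ex1I)
  define k where "k = \<lfloor>log 10 x\<rfloor>"
  have pw: "(10::real) powi j = 10 powr real_of_int j" for j :: int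
    by (simp add: powr_real_of_int')
  have x: "x = 10 powr log 10 x"
    using assms by simp
  have "x / 10 powi k = 10 powr (log 10 x - k)"
    using assms by (simp add: pw powr_diff)
  moreover have "0 \<le> log 10 x - k" "log 10 x - k < 1"
    unfolding k_def by linarith+
  ultimately have "1 \<le> x / 10 powi k" "x / 10 powi k < 10"
    using powr_less_cancel_iff[of 10 "log 10 x - k" 1] by (simp_all add: ge_one_powr_ge_zero)
  moreover have "x = (x / 10 powi k) * 10 powi k"
    by simp
  ultimately show "\<exists>s. 1 \<le> s \<and> s < 10 \<and> (\<exists>k::int. x = s * 10 powi k)"
    by blast
next
  fix s t :: real
  assume "1 \<le> s \<and> s < 10 \<and> (\<exists>k::int. x = s * 10 powi k)"
  then obtain j :: int where s: "1 \<le> s" "s < 10" and j: "x = s * 10 powi j" by blast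
  assume "1 \<le> t \<and> t < 10 \<and> (\<exists>k::int. x = t * 10 powi k)"
  then obtain k :: int where t: "1 \<le> t" "t < 10" and k: "x = t * 10 powi k" by blast
  have pw: "(10::real) powi i = 10 powr real_of_int i" for i :: int
    by (simp add: powr_real_of_int')
  have l: "log 10 x = log 10 u + i" if "1 \<le> u" "x = u * 10 powi i" for u and i :: int
    using that by (simp add: log_mult pw)
  have fl: "\<lfloor>log 10 u\<rfloor> = 0" if "1 \<le> u" "u < 10" for u :: real
    using that by (simp add: floor_eq_iff zero_le_log_cancel_iff)
  have "\<lfloor>log 10 s + j\<rfloor> = \<lfloor>log 10 t + k\<rfloor>"
    using l[OF s(1) j] l[OF t(1) k] by simp
  then have "j = k"
    using fl[OF s] fl[OF t] by simp
  then show "s = t"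
    using j k by simp
qed

text \<open>For \<open>x \<le> 0\<close> the description below is void and \<open>significand x\<close> is some
  fixed but unspecified real number.\<close>

definition significand :: "real \<Rightarrow> real" where
  "significand x = (THE s. 1 \<le> s \<and> s < 10 \<and> (\<exists>k::int. x = s * 10 powi k))"

lemma significand:
  assumes "x > 0"
  shows "1 \<le> significand x" "significand x < 10" "\<exists>k::int. x = significand x * 10 powi k"
  using theI'[OF significand_ex1[OF assms]] unfolding significand_def by blast+

definition sig_ind :: "real \<Rightarrow> real \<Rightarrow> real" where
  "sig_ind s x = (if significand x \<le> s then 1 else 0)"

text \<open>\<open>stick L p N i\<close> is the length of the \<open>i\<close>-th of the \<open>N\<close> sticks (\<open>1 \<le> i \<le> N\<close>) present
  after the first \<open>N - 1\<close> cuts, at proportions \<open>p 1, \<dots>, p (N - 1)\<close>.\<close>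

definition stick :: "real \<Rightarrow> (nat \<Rightarrow> real) \<Rightarrow> nat \<Rightarrow> nat \<Rightarrow> real" where
  "stick L p N i =
     (if i < N then L * (\<Prod>j=1..<i. p j) * (1 - p i) else L * (\<Prod>j=1..<N. p j))"

text \<open>The cutting process: the \<open>N\<close>-th cut splits the \<open>N\<close>-th stick at proportion \<open>p N\<close> and
  leaves all others alone.\<close>

lemma stick_initial: "stick L p 1 1 = L"
  by (simp add: stick_def)

lemma stick_cut:
  assumes "N \<ge> 1"
  shows "\<And>i. i < N \<Longrightarrow> stick L p (Suc N) i = stick L p N i"
    and "stick L p (Suc N) N = stick L p N N * (1 - p N)"
    and "stick L p (Suc N) (Suc N) = stick L p N N * p N"
  using assms by (simp_all add: stick_def)

definition sig_prop :: "real \<Rightarrow> (nat \<Rightarrow> real) \<Rightarrow> nat \<Rightarrow> real \<Rightarrow> real" where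
  "sig_prop L p N s = (1 / real N) * (\<Sum>i=1..N. sig_ind s (stick L p N i))"

end

theory Submission
  imports Defs
begin

text \<open>
  If a function \<open>g\<close> of the significand has mean zero under Benford's law, then averaging
  \<open>g (x * u)\<close> over a uniform \<open>u\<close> keeps this property, and it shrinks the supremum norm by a
  constant factor: up to the decimal scale, the average is an integral over \<open>[1/10, 1)\<close>, from
  which a multiple of the vanishing integral of \<open>g (x * u) / u\<close> can be subtracted. For \<open>i < j\<close> the
  \<open>j\<close>-th stick contains \<open>j - i - 1\<close> cutting proportions that are independent of the \<open>i\<close>-th
  stick. Integrating these out shows that the centred indicators of the two sticks have correlation
  at most \<open>(9/11) ^ (j - i - 1)\<close>. Hence \<open>sig_prop\<close> has mean square distance \<open>O(1/N)\<close> from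
  \<open>log 10 s\<close>, which bounds both its variance and the square of its bias.
\<close>

section \<open>Integrals against the uniform law on (0, 1) and over bounded intervals\<close>

abbreviation unif :: "real measure" where
  "unif \<equiv> uniform_measure lborel {0<..<1}"

lemma prob_space_unif: "prob_space unif"
  by (rule prob_space_uniform_measure) auto

lemma integral_unif:
  fixes f :: "real \<Rightarrow> real"
  assumes [measurable]: "f \<in> borel_measurable borel"
  shows "(\<integral>u. f u \<partial>unif) = (LINT u:{0<..<1}|lborel. f u)"
proof -
  \<comment> \<open>The interval has length 1, so the normalising division in
    \<open>uniform_measure\<close> disappears.\<close>
  have "unif = density lborel (\<lambda>u. ennreal (indicator {0<..<1::real} u))"
    by (auto simp: uniform_measure_def indicator_def intro!: arg_cong2[where f=density])
  then show ?thesis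
    by (simp add: integral_density set_lebesgue_integral_def)
qed

lemma set_integrable_bounded:
  fixes f :: "real \<Rightarrow> real"
  assumes "f \<in> borel_measurable borel" "A \<in> sets borel" "A \<subseteq> {a..b}" "\<And>x. x \<in> A \<Longrightarrow> \<bar>f x\<bar> \<le> B"
  shows "set_integrable lborel A f"
  unfolding set_integrable_def
proof (rule integrableI_bounded_set[where A=A and B=B])
  have "emeasure lborel A \<le> emeasure lborel {a..b}"
    using assms by (intro emeasure_mono) auto
  also have "\<dots> < \<infinity>"
    by (simp add: emeasure_lborel_Icc_eq)
  finally show "emeasure lborel A < \<infinity>" .
qed (use assms in \<open>auto simp: indicator_def\<close>)

lemma set_integral_scale:
  fixes f :: "real \<Rightarrow> real"
  assumes "c > 0"
  shows "(LINT v:{a * c..<b * c}|lborel. f v) = c * (LINT v:{a..<b}|lborel. f (c * v))"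
    and "(LINT v:{a * c<..<b * c}|lborel. f v) = c * (LINT v:{a<..<b}|lborel. f (c * v))"
proof -
  have 1: "indicator {a * c..<b * c} (c * v) = (indicator {a..<b} v :: real)"
    "indicator {a * c<..<b * c} (c * v) = (indicator {a<..<b} v :: real)" for v
    using assms by (auto simp: indicator_def mult.commute)
  show "(LINT v:{a * c..<b * c}|lborel. f v) = c * (LINT v:{a..<b}|lborel. f (c * v))"
    "(LINT v:{a * c<..<b * c}|lborel. f v) = c * (LINT v:{a<..<b}|lborel. f (c * v))"
    unfolding set_lebesgue_integral_def
    using assms by (subst lborel_integral_real_affine[where c=c and t=0]; simp add: 1)+
qed

section \<open>The averaging operator of one uniform cut\<close>

text \<open>This is the transition operator of the Markov chain formed by the piece that is cut
  again: a length \<open>x\<close> becomes \<open>x * u\<close>.\<close>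

definition cut_avg :: "(real \<Rightarrow> real) \<Rightarrow> real \<Rightarrow> real" where
  "cut_avg g x = (\<integral>u. g (x * u) \<partial>unif)"

text \<open>The last clause says that \<open>g\<close> has mean zero under Benford's law, whose density on a decade is
  proportional to \<open>1 / v\<close>; asking for it on every decade \<open>[x/10, x)\<close> makes its preservation
  by \<open>cut_avg\<close> a direct application of Fubini's theorem.\<close>

definition benford_null :: "real \<Rightarrow> (real \<Rightarrow> real) \<Rightarrow> bool" where
  "benford_null C g \<longleftrightarrow> g \<in> borel_measurable borel \<and> (\<forall>x. \<bar>g x\<bar> \<le> C) \<and> (\<forall>x. g (10 * x) = g x) \<and>
     (\<forall>x. (LINT u:{1/10..<1}|lborel. g (x * u) / u) = 0)"

lemma benford_null_measurable [measurable_dest]: "benford_null C g \<Longrightarrow> g \<in> borel_measurable borel"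
  by (simp add: benford_null_def)

lemma benford_null_bound: "benford_null C g \<Longrightarrow> \<bar>g x\<bar> \<le> C"
  by (simp add: benford_null_def)

text \<open>Invariance under multiplication by 10 turns the average over (0, 1) into 10/9 times the
  integral over [1/10, 1). There the weight 1 may be replaced by 1 - (2/11) / u, since the integral
  of \<open>g (x * u) / u\<close> vanishes. The new weight is at most 9/11 in absolute value, and
  the interval length 9/10 cancels the factor 10/9.\<close>

lemma cut_avg_contraction:
  assumes g: "benford_null C g"
  shows "\<bar>cut_avg g x\<bar> \<le> 9/11 * C"
proof -
  note [measurable] = benford_null_measurable[OF g]
  have B: "\<bar>g y\<bar> \<le> C" and per: "g (10 * y) = g y" for y
    using g by (auto simp: benford_null_def)
  have C: "C \<ge> 0"
    using B[of 0] by linarith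
  have null: "(LINT u:{1/10..<1}|lborel. g (x * u) / u) = 0"
    using g by (auto simp: benford_null_def)
  have T: "cut_avg g x = (LINT u:{0<..<1}|lborel. g (x * u))"
    unfolding cut_avg_def by (rule integral_unif) measurable
  have int: "set_integrable lborel {0<..<1/10} (\<lambda>u. g (x * u))" "set_integrable lborel {1/10..<1} (\<lambda>u. g (x * u))"
    by (rule set_integrable_bounded[where a=0 and b=1 and B=C]; use B in auto)+
  have "cut_avg g x = (LINT u:{0<..<1/10} \<union> {1/10..<1}|lborel. g (x * u))"
    unfolding T by (intro arg_cong[where f="\<lambda>A. set_lebesgue_integral _ A _"]) auto
  also have "\<dots> = (LINT u:{0<..<1/10}|lborel. g (x * u)) + (LINT u:{1/10..<1}|lborel. g (x * u))"
    using int by (intro set_integral_Un) auto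
  \<comment> \<open>Rescaling (0, 1/10) to (0, 1) costs a factor 1/10 and leaves the integrand
    unchanged by periodicity. The average thus reappears on the right, and the equation can be
    solved for it.\<close>
  also have "(LINT u:{0<..<1/10}|lborel. g (x * u)) = 1/10 * cut_avg g x"
  proof -
    have eq: "g (x * (1/10 * u)) = g (x * u)" for u
      using per[of "x * (1/10 * u)"] by simp
    show ?thesis
      unfolding T using set_integral_scale(2)[of "1/10" 0 1 "\<lambda>u. g (x * u)"]
      by (simp only: eq mult_1_left mult_zero_left)
  qed
  finally have eq: "cut_avg g x = 10/9 * (LINT u:{1/10..<1}|lborel. g (x * u))"
    by linarith
  \<comment> \<open>\<open>c = 2/11\<close> minimises the maximum of \<open>\<bar>1 - c / u\<bar>\<close> over \<open>[1/10, 1]\<close>.\<close>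
  have le: "\<bar>1 - 2/11 / u\<bar> \<le> 9/11" if "u \<in> {1/10..<1}" for u :: real
    using that by (auto simp: abs_le_iff field_simps)
  have int': "set_integrable lborel {1/10..<1} (\<lambda>u. g (x * u) / u)"
  proof (rule set_integrable_bounded[where a=0 and b=1 and B="10 * C"])
    show "\<bar>g (x * u) / u\<bar> \<le> 10 * C" if "u \<in> {1/10..<1}" for u
    proof -
      have "\<bar>g (x * u) / u\<bar> \<le> C / (1/10)"
        unfolding abs_divide using that B[of "x * u"] C by (intro frac_le) auto
      then show ?thesis by simp
    qed
  qed auto
  have "(LINT u:{1/10..<1}|lborel. g (x * u)) =
      (LINT u:{1/10..<1}|lborel. g (x * u)) - 2/11 * (LINT u:{1/10..<1}|lborel. g (x * u) / u)"
    by (simp add: null)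
  also have "\<dots> = (LINT u:{1/10..<1}|lborel. g (x * u) - 2/11 * (g (x * u) / u))"
    using int' int
    by (subst set_integral_diff(2)) (simp_all only: set_integrable_mult_right set_integral_mult_right)
  finally have eq2: "(LINT u:{1/10..<1}|lborel. g (x * u)) =
    (LINT u:{1/10..<1}|lborel. g (x * u) - 2/11 * (g (x * u) / u))" .
  have "\<bar>LINT u:{1/10..<1}|lborel. g (x * u)\<bar> \<le> (LINT u:{1/10..<1::real}|lborel. 9/11 * C)"
    unfolding eq2 unfolding set_lebesgue_integral_def real_norm_def[symmetric]
  proof (rule Bochner_Integration.integral_norm_bound_integral)
    show "integrable lborel (\<lambda>u. indicator {1/10..<1} u *\<^sub>R (g (x * u) - 2/11 * (g (x * u) / u)))"
      using int int' unfolding set_integrable_def[symmetric] by (intro set_integral_diff set_integrable_mult_right) auto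
    show "integrable lborel (\<lambda>u::real. indicator {1/10..<1} u *\<^sub>R (9/11 * C))"
      unfolding set_integrable_def[symmetric] by (rule set_integrable_bounded[where a=0 and b=1 and B="9/11*C"]) (use C in auto)
    fix u :: real
    have "\<bar>g (x * u) - 2/11 * (g (x * u) / u)\<bar> \<le> 9/11 * C" if u: "u \<in> {1/10..<1}"
    proof -
      have "\<bar>g (x * u) - 2/11 * (g (x * u) / u)\<bar> = \<bar>1 - 2/11 / u\<bar> * \<bar>g (x * u)\<bar>"
        by (simp add: abs_mult[symmetric] algebra_simps)
      also have "\<dots> \<le> 9/11 * C"
        using le[OF u] B by (intro mult_mono) auto
      finally show ?thesis .
    qed
    then show "norm (indicator {1/10..<1} u *\<^sub>R (g (x * u) - 2/11 * (g (x * u) / u))) \<le> indicator {1/10..<1} u *\<^sub>R (9/11 * C)"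
      by (auto simp: indicator_def)
  qed
  also have "\<dots> = 9/10 * (9/11 * C)"
    by (simp add: set_lebesgue_integral_def)
  finally show ?thesis
    unfolding eq by (simp add: abs_mult)
qed

text \<open>After exchanging the integrals, the inner one for a fixed proportion \<open>w\<close> is
  the mean-zero condition on \<open>g\<close> at the scale \<open>x * w\<close>. The new bound is
  the contraction above.\<close>

lemma cut_avg_benford_null:
  assumes g: "benford_null C g"
  shows "benford_null (9/11 * C) (cut_avg g)"
proof -
  note [measurable] = benford_null_measurable[OF g]
  interpret U: prob_space unif by (rule prob_space_unif)
  have B: "\<bar>g y\<bar> \<le> C" and per: "g (10 * y) = g y" for y
    using g by (auto simp: benford_null_def)
  have C: "C \<ge> 0"
    using B[of 0] by linarith
  have [measurable]: "cut_avg g \<in> borel_measurable borel"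
    unfolding cut_avg_def by measurable
  have null: "(LINT u:{1/10..<1}|lborel. cut_avg g (x * u) / u) = 0" for x
  proof -
    let ?h = "\<lambda>w u. indicator {1/10..<1} u * (g (x * u * w) / u) :: real"
    interpret P: pair_sigma_finite unif lborel ..
    have "integrable (unif \<Otimes>\<^sub>M lborel) (case_prod ?h)"
    \<comment> \<open>The integrand lives on a set of finite measure where \<open>u\<close> is at
      least 1/10, hence the bound \<open>10 * C\<close>.\<close>
    proof (rule integrableI_bounded_set[where A="UNIV \<times> {1/10..<1}" and B="10 * C"])
      show "emeasure (unif \<Otimes>\<^sub>M lborel) (UNIV \<times> {1/10..<1::real}) < \<infinity>"
        using U.emeasure_space_1 by (simp add: lborel.emeasure_pair_measure_Times)
      have "\<bar>?h w u\<bar> \<le> 10 * C" for w u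
      proof (cases "u \<in> {1/10..<1}")
        case True
        then have "\<bar>g (x * u * w) / u\<bar> \<le> C / (1/10)"
          unfolding abs_divide using B[of "x * u * w"] C by (intro frac_le) auto
        then show ?thesis using True by simp
      qed (use C in auto)
      then show "AE z in unif \<Otimes>\<^sub>M lborel. z \<in> UNIV \<times> {1/10..<1} \<longrightarrow> norm (case_prod ?h z) \<le> 10 * C"
        by (intro AE_I2) (simp only: split_beta real_norm_def simp_thms)
    qed (auto simp: indicator_def)
    then have "(\<integral>u. (\<integral>w. ?h w u \<partial>unif) \<partial>lborel) = (\<integral>w. (\<integral>u. ?h w u \<partial>lborel) \<partial>unif)"
      by (rule P.Fubini_integral)
    also have "\<dots> = (\<integral>w. (LINT u:{1/10..<1}|lborel. g (x * w * u) / u) \<partial>unif)"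
      by (simp add: set_lebesgue_integral_def mult_ac)
    also have "\<dots> = 0"
      using g by (simp add: benford_null_def)
    finally show ?thesis
      by (simp add: set_lebesgue_integral_def cut_avg_def)
  qed
  have "cut_avg g (10 * x) = cut_avg g x" for x
    unfolding cut_avg_def using per[of "x * _"] by (simp add: mult.assoc)
  then show ?thesis
    using null cut_avg_contraction[OF g] by (simp add: benford_null_def)
qed

lemma cut_avg_iterate:
  assumes "benford_null C g"
  shows "benford_null ((9/11) ^ n * C) ((cut_avg ^^ n) g)"
proof (induction n)
  case (Suc n)
  from cut_avg_benford_null[OF this] show ?case by (simp add: mult.assoc)
qed (use assms in simp)

section \<open>Integrals against dv/v over one decade\<close>

text \<open>The measure dv/v is invariant under scaling and \<open>g\<close> under multiplication by
  10, so every window [x/10, x) gives the same integral. The part of the window below a power of ten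
  \<open>r\<close> is moved up one decade, which produces the window [r, 10 r); this one scales to
  [1, 10).\<close>

lemma log_uniform_integral_eq:
  fixes g :: "real \<Rightarrow> real"
  assumes [measurable]: "g \<in> borel_measurable borel" and B: "\<And>x. \<bar>g x\<bar> \<le> B"
    and per: "\<And>x. g (10 * x) = g x" and x: "x > 0"
  shows "(LINT u:{1/10..<1}|lborel. g (x * u) / u) = (LINT v:{1..<10}|lborel. g v / v)"
proof -
  define H where "H a b = (LINT v:{a..<b}|lborel. g v / v)" for a b
  have scale: "H (a * c) (b * c) = (LINT v:{a..<b}|lborel. g (c * v) / v)" if "c > 0" for a b c
    unfolding H_def using that by (subst set_integral_scale(1)) (auto simp flip: set_integral_mult_right)
  have per10: "H (a * 10) (b * 10) = H a b" for a b
    by (subst scale) (auto simp: per H_def)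
  have add: "H a c = H a b + H b c" if "0 < a" "a \<le> b" "b \<le> c" for a b c
  proof -
    have int: "set_integrable lborel A (\<lambda>v. g v / v)" if "A \<in> sets borel" "A \<subseteq> {a..<c}" for A
    proof (rule set_integrable_bounded[where a=a and b=c and B="B / a"])
      show "\<bar>g v / v\<bar> \<le> B / a" if "v \<in> A" for v
        unfolding abs_divide using that \<open>A \<subseteq> _\<close> \<open>0 < a\<close> B[of v] by (intro frac_le) auto
    qed (use that in auto)
    have "{a..<c} = {a..<b} \<union> {b..<c}"
      using that by auto
    then show ?thesis
      unfolding H_def using that by (auto intro!: set_integral_Un int)
  qed
  have powi: "g (y * 10 powi k) = g y" for y and k :: int
  proof (induction k rule: int_induct[where k=0])
    case (step1 i)
    then show ?case using per[of "y * 10 powi i"] by (simp add: power_int_add mult_ac)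
  next
    case (step2 i)
    then show ?case using per[of "y * 10 powi (i - 1)"] by (simp add: power_int_diff mult_ac)
  qed simp
  obtain k :: int where k: "x = significand x * 10 powi k"
    using significand(3)[OF x] by blast
  \<comment> \<open>The largest power of ten that does not exceed \<open>x\<close>.\<close>
  define r :: real where "r = 10 powi k"
  have r: "r > 0" by (simp add: r_def)
  have "1 * r \<le> significand x * r" "significand x * r < 10 * r"
    using significand(1,2)[OF x] r by (intro mult_right_mono mult_strict_right_mono; simp)+
  then have rx: "r \<le> x" "x < 10 * r"
    using k unfolding r_def[symmetric] by simp_all
  have "(LINT u:{1/10..<1}|lborel. g (x * u) / u) = H (x / 10) x"
    using scale[OF x, of "1/10" 1] by simp
  also have "\<dots> = H (x / 10) r + H r x"
    using rx x by (intro add) auto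
  also have "H (x / 10) r = H x (10 * r)"
    using per10[of "x / 10" r] by (simp add: mult.commute)
  also have "H x (10 * r) + H r x = H r (10 * r)"
    using add[of r x "10 * r"] rx r by simp
  also have "\<dots> = H (1 * r) (10 * r)"
    by simp
  also have "\<dots> = (LINT v:{1..<10}|lborel. g v / v)"
    using r powi by (subst scale) (auto simp: r_def mult.commute)
  finally show ?thesis .
qed

section \<open>The significand and its centred indicator\<close>

lemma significand_mult_10: "significand (10 * x) = significand x"
proof -
  have "(\<exists>k::int. 10 * x = s * 10 powi k) \<longleftrightarrow> (\<exists>k::int. x = s * 10 powi k)" for s
  proof safe
    fix k :: int assume "10 * x = s * 10 powi k"
    then show "\<exists>k::int. x = s * 10 powi k"
      by (intro exI[of _ "k - 1"]) (simp add: power_int_diff)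
  next
    fix k :: int assume "x = s * 10 powi k"
    then show "\<exists>k'::int. 10 * (s * 10 powi k) = s * 10 powi k'"
      by (intro exI[of _ "k + 1"]) (simp add: power_int_add)
  qed
  then show ?thesis
    by (simp add: significand_def)
qed

lemma significand_eq:
  assumes "1 \<le> x" "x < 10"
  shows "significand x = x"
proof -
  have "x = x * 10 powi 0" by simp
  then show ?thesis
    using assms significand_ex1[of x] significand[of x] by (metis less_le_trans zero_less_one)
qed

text \<open>This closed form replaces the definite description, which gives no direct access to
  measurability.\<close>

lemma significand_eq_powr:
  assumes "x > 0"
  shows "significand x = x / 10 powr \<lfloor>log 10 x\<rfloor>"
proof -
  obtain k :: int where k: "x = significand x * 10 powi k"
    using significand(3)[OF assms] by blast
  note s = significand(1,2)[OF assms]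
  have pw: "(10::real) powi k = 10 powr real_of_int k"
    by (simp add: powr_real_of_int')
  have "log 10 x = log 10 (significand x) + k"
    by (subst k) (use s in \<open>simp add: log_mult pw\<close>)
  moreover have "0 \<le> log 10 (significand x)" "log 10 (significand x) < 1"
    using s by (simp_all add: zero_le_log_cancel_iff)
  ultimately have "\<lfloor>log 10 x\<rfloor> = k"
    by linarith
  then show ?thesis
    using k pw by (metis nonzero_mult_div_cancel_right power_int_eq_0_iff zero_neq_numeral)
qed

lemma measurable_significand [measurable]: "significand \<in> borel_measurable borel"
proof -
  have "significand x = (if x > 0 then x / 10 powr \<lfloor>log 10 x\<rfloor> else significand 0)" for x
  proof (cases "x > 0")
    case False
    \<comment> \<open>For nonpositive arguments no number fits the description, so they all share
      one unspecified value and \<open>significand\<close> is constant there.\<close>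
    have "\<not> (1 \<le> s \<and> s < 10 \<and> (\<exists>k::int. y = s * 10 powi k))" if "y \<le> 0" for s y :: real
      using that zero_less_power_int[of "10::real"] by (force simp: mult_le_0_iff simp flip: not_less)
    then have "significand y = (THE s. False)" if "y \<le> 0" for y
      unfolding significand_def using that by (intro arg_cong[where f=The]) blast
    then show ?thesis using False by simp
  qed (simp add: significand_eq_powr)
  then have "significand = (\<lambda>x. if x > 0 then x / 10 powr \<lfloor>log 10 x\<rfloor> else significand 0)"
    by (rule ext)
  also have "\<dots> \<in> borel_measurable borel"
    by measurable
  finally show ?thesis .
qed

lemma measurable_sig_ind [measurable]: "sig_ind s \<in> borel_measurable borel"
  unfolding sig_ind_def by measurable

text \<open>The value \<open>0\<close> for \<open>x \<le> 0\<close>, where \<open>significand\<close> is unspecified, makes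
  \<open>benford_null\<close> hold without a positivity condition.\<close>

definition sig_dev :: "real \<Rightarrow> real \<Rightarrow> real" where
  "sig_dev s x = (if x > 0 then sig_ind s x - log 10 s else 0)"

lemma integral_inverse:
  fixes b :: real
  assumes "1 \<le> b"
  shows "(LINT v:{1..b}|lborel. 1 / v) = ln b" "set_integrable lborel {1..b} (\<lambda>v. 1 / v)"
proof -
  have c: "continuous_on {1..b} (\<lambda>v. 1 / v)"
    by (auto intro!: continuous_intros)
  then show "set_integrable lborel {1..b} (\<lambda>v. 1 / v)"
    by (rule borel_integrable_atLeastAtMost')
  have "(LINT v:{1..b}|lborel. 1 / v) = ln b - ln 1"
    unfolding set_lebesgue_integral_def
    by (rule integral_FTC_atLeastAtMost)
       (use assms c in \<open>auto intro!: derivative_eq_intros simp flip: has_real_derivative_iff_has_vector_derivative\<close>)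
  then show "(LINT v:{1..b}|lborel. 1 / v) = ln b" by simp
qed

text \<open>On [1, 10) the significand is the identity, so the mean-zero condition reduces to ln s -
  \<open>log 10 s\<close> * ln 10 = 0. All other decades follow by scale invariance.\<close>

lemma benford_null_sig_dev:
  assumes s: "s \<in> {1..<10}"
  shows "benford_null 1 (sig_dev s)"
proof -
  have l: "0 \<le> log 10 s" "log 10 s < 1"
    using s by (auto simp: zero_le_log_cancel_iff)
  have [measurable]: "sig_dev s \<in> borel_measurable borel"
    unfolding sig_dev_def by measurable
  have B: "\<bar>sig_dev s x\<bar> \<le> 1" for x
    using l by (auto simp: sig_dev_def sig_ind_def)
  have per: "sig_dev s (10 * x) = sig_dev s x" for x
    by (simp add: sig_dev_def sig_ind_def significand_mult_10)
  have "(LINT v:{1..<10}|lborel. sig_dev s v / v) = (LINT v:{1..s}|lborel. 1 / v) - log 10 s * (LINT v:{1..10}|lborel. 1 / v)"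
  proof -
    have "(LINT v:{1..<10}|lborel. sig_dev s v / v) =
       (\<integral>v. indicator {1..s} v *\<^sub>R (1 / v) - log 10 s * (indicator {1..10} v *\<^sub>R (1 / v)) \<partial>lborel)"
      unfolding set_lebesgue_integral_def
    proof (rule integral_cong_AE)
      \<comment> \<open>The two integrands differ at 10: the decade is half-open, while the
        integrals of 1/v are taken over closed intervals.\<close>
      have "AE v in lborel. v \<noteq> (10::real)"
        by (rule AE_lborel_singleton)
      then show "AE v in lborel. indicator {1..<10} v *\<^sub>R (sig_dev s v / v) =
          indicator {1..s} v *\<^sub>R (1 / v) - log 10 s * (indicator {1..10} v *\<^sub>R (1 / v))"
      proof eventually_elim
        case (elim v)
        then show ?case
          using s by (auto simp: indicator_def sig_dev_def sig_ind_def significand_eq diff_divide_distrib)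
      qed
    qed auto
    then show ?thesis
      using integral_inverse(2)[of s] integral_inverse(2)[of 10] s
      unfolding set_lebesgue_integral_def set_integrable_def integral_mult_right_zero[symmetric]
      by (subst Bochner_Integration.integral_diff[symmetric]) (simp_all only: integrable_mult_right atLeastLessThan_iff)
  qed
  also have "\<dots> = 0"
    using s by (simp add: integral_inverse(1) log_def)
  finally have *: "(LINT v:{1..<10}|lborel. sig_dev s v / v) = 0" .
  have "(LINT u:{1/10..<1}|lborel. sig_dev s (x * u) / u) = 0" for x
  proof (cases "x > 0")
    case True
    then show ?thesis
      using log_uniform_integral_eq[of "sig_dev s" 1 x] B per * by simp
  next
    \<comment> \<open>Here \<open>x * u\<close> is nonpositive, so the default value 0 of
      \<open>sig_dev\<close> makes the integrand vanish.\<close>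
    case False
    then have "indicator {1/10..<1} u *\<^sub>R (sig_dev s (x * u) / u) = 0" for u :: real
      by (auto simp: indicator_def sig_dev_def zero_less_mult_iff)
    then show ?thesis
      by (simp only: set_lebesgue_integral_def integral_zero)
  qed
  then show ?thesis
    using B per by (simp add: benford_null_def)
qed

section \<open>Integrating out coordinates of a product of uniform laws\<close>

lemma measurable_PiM_unif_component:
  "l \<in> K \<Longrightarrow> (\<lambda>x. x l) \<in> borel_measurable (Pi\<^sub>M K (\<lambda>_. unif))"
  using measurable_component_singleton[of l K "\<lambda>_. unif"] by (simp cong: measurable_cong_sets)

lemma prob_space_PiM_unif: "prob_space (Pi\<^sub>M K (\<lambda>_. unif))"
  by (intro prob_space_PiM prob_space_unif)

lemma integral_PiM_unif_insert:
  fixes F :: "('i \<Rightarrow> real) \<Rightarrow> real"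
  assumes "finite K" "l \<in> K" and [measurable]: "F \<in> borel_measurable (Pi\<^sub>M K (\<lambda>_. unif))" and "\<And>x. \<bar>F x\<bar> \<le> B"
  shows "(\<integral>x. F x \<partial>Pi\<^sub>M K (\<lambda>_. unif)) = (\<integral>x. \<integral>v. F (x(l := v)) \<partial>unif \<partial>Pi\<^sub>M (K - {l}) (\<lambda>_. unif))"
proof -
  interpret U: prob_space unif by (rule prob_space_unif)
  interpret product_sigma_finite "\<lambda>_::'i. unif" ..
  interpret P: prob_space "Pi\<^sub>M K (\<lambda>_. unif)" by (rule prob_space_PiM_unif)
  have K: "insert l (K - {l}) = K"
    using assms by auto
  have "integrable (Pi\<^sub>M K (\<lambda>_. unif)) F"
    using assms by (intro P.integrable_const_bound[where B=B]) auto
  then show ?thesis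
    using product_integral_insert[of "K - {l}" l F] assms K by simp
qed

text \<open>The coordinates in \<open>J\<close> are integrated out one at a time. Since
  \<open>z\<close> and \<open>y\<close> do not involve them, each integration acts on the argument
  of \<open>g\<close> alone and applies \<open>cut_avg\<close> once.\<close>

lemma integral_cut_avg_iterate:
  fixes z y :: "('i \<Rightarrow> real) \<Rightarrow> real"
  assumes K: "finite K" and J: "J \<subseteq> K" and g: "benford_null C g"
    and z: "z \<in> borel_measurable (Pi\<^sub>M K (\<lambda>_. unif))" "\<And>x. \<bar>z x\<bar> \<le> B"
    and y: "y \<in> borel_measurable (Pi\<^sub>M K (\<lambda>_. unif))"
    and z_indep: "\<And>l x v. l \<in> J \<Longrightarrow> z (x(l := v)) = z x"
    and y_indep: "\<And>l x v. l \<in> J \<Longrightarrow> y (x(l := v)) = y x"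
  shows "(\<integral>x. z x * g (y x * (\<Prod>l\<in>J. x l)) \<partial>Pi\<^sub>M K (\<lambda>_. unif)) =
    (\<integral>x. z x * (cut_avg ^^ card J) g (y x) \<partial>Pi\<^sub>M K (\<lambda>_. unif))"
proof -
  have "finite J"
    using K J by (rule rev_finite_subset)
  then show ?thesis
    using J y z_indep y_indep
  proof (induction J arbitrary: y)
    case (insert l J)
    let ?P = "Pi\<^sub>M K (\<lambda>_. unif)" and ?Q = "Pi\<^sub>M (K - {l}) (\<lambda>_. unif)"
    interpret U: prob_space unif by (rule prob_space_unif)
    note [measurable] = z(1) insert.prems(2)
    have l: "l \<in> K" using insert.prems(1) by simp
    note [measurable] = measurable_PiM_unif_component[OF l]
    define h where "h = (cut_avg ^^ card J) g"
    define D where "D = (9/11) ^ card J * C"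
    have h: "benford_null D h"
      unfolding h_def D_def by (rule cut_avg_iterate[OF g])
    have h': "benford_null (9/11 * D) (cut_avg h)"
      by (rule cut_avg_benford_null[OF h])
    have [measurable]: "h \<in> borel_measurable borel" "cut_avg h \<in> borel_measurable borel"
      by (rule benford_null_measurable[OF h] benford_null_measurable[OF h'])+
    have bound: "\<bar>z x * k w\<bar> \<le> B * E" if "benford_null E k" for x k w E
      unfolding abs_mult using z(2)[of x] benford_null_bound[OF that] by (intro mult_mono) auto
    \<comment> \<open>The factor \<open>x l\<close> is absorbed into \<open>y\<close>: the product
      \<open>y x * x l\<close> is still free of the coordinates in \<open>J\<close>. For this the
      induction is general in \<open>y\<close>.\<close>
    have "(\<integral>x. z x * g (y x * (\<Prod>l\<in>insert l J. x l)) \<partial>?P) =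
        (\<integral>x. z x * g ((y x * x l) * (\<Prod>l\<in>J. x l)) \<partial>?P)"
      using insert.hyps by (simp add: mult.assoc)
    also have "\<dots> = (\<integral>x. z x * h (y x * x l) \<partial>?P)"
      unfolding h_def
    proof (rule insert.IH)
      show "y (x(l' := v)) * (x(l' := v)) l = y x * x l" if "l' \<in> J" for l' x v
      proof -
        have "(x(l' := v)) l = x l"
          using insert.hyps that by auto
        then show ?thesis
          using insert.prems(4)[of l' x v] that by (simp only: insertI2)
      qed
      show "J \<subseteq> K"
        using insert.prems(1) by simp
      show "(\<lambda>x. y x * x l) \<in> borel_measurable ?P"
        using insert.prems(2) measurable_PiM_unif_component[OF l] by (rule borel_measurable_times)
      show "z (x(l' := v)) = z x" if "l' \<in> J" for l' x v
        using insert.prems(3)[of l' x v] that by (simp only: insertI2)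
    qed
    also have "\<dots> = (\<integral>x. \<integral>v. z (x(l := v)) * h (y (x(l := v)) * (x(l := v)) l) \<partial>unif \<partial>?Q)"
      by (rule integral_PiM_unif_insert[OF K l _ bound[OF h]]) measurable
    also have "\<dots> = (\<integral>x. z x * cut_avg h (y x) \<partial>?Q)"
      by (simp add: insert.prems cut_avg_def)
    \<comment> \<open>The integrand no longer depends on coordinate \<open>l\<close>, and
      \<open>unif\<close> has mass 1, so this coordinate can be put back to recover the full product
      measure.\<close>
    also have "\<dots> = (\<integral>x. \<integral>v. z (x(l := v)) * cut_avg h (y (x(l := v))) \<partial>unif \<partial>?Q)"
      using U.prob_space by (simp add: insert.prems)
    also have "\<dots> = (\<integral>x. z x * cut_avg h (y x) \<partial>?P)"
      by (rule integral_PiM_unif_insert[OF K l _ bound[OF h'], symmetric]) measurable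
    finally show ?case
      using insert.hyps by (simp add: h_def)
  qed simp
qed

section \<open>Dependence of the sticks on the cutting proportions, and their correlations\<close>

text \<open>This isolates the proportions strictly between \<open>i\<close> and \<open>j\<close>,
  which do not enter stick \<open>i\<close>. The last stick \<open>j = N\<close> is what remains
  after all cuts and has no factor \<open>1 - x j\<close>.\<close>

lemma stick_split:
  assumes "1 \<le> i" "i < j" "j \<le> N"
  shows "stick L x N j =
    L * (\<Prod>l=1..i. x l) * (if j < N then 1 - x j else 1) * (\<Prod>l\<in>{i<..<j}. x l)"
proof -
  have "{1..<j} = {1..i} \<union> {i<..<j}"
    using assms by auto
  moreover have disj: "{1..i} \<inter> {i<..<j} = {}"
    by auto
  ultimately have "(\<Prod>l=1..<j. x l) = (\<Prod>l=1..i. x l) * (\<Prod>l\<in>{i<..<j}. x l)"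
    by (metis prod.union_disjoint finite_atLeastAtMost finite_greaterThanLessThan disj)
  then show ?thesis
    using assms by (cases "j = N") (simp_all add: stick_def)
qed

text \<open>This allows the sequence of proportions to be restricted to the finite index set
  \<open>{1..<N}\<close>, on which the product measure lives.\<close>

lemma stick_cong:
  assumes "\<And>l. 1 \<le> l \<Longrightarrow> l < N \<Longrightarrow> x l = x' l" "1 \<le> i" "i \<le> N"
  shows "stick L x N i = stick L x' N i"
proof -
  have "(\<Prod>l=1..<k. x l) = (\<Prod>l=1..<k. x' l)" if "k \<le> N" for k
    using assms that by (intro prod.cong) auto
  then show ?thesis
    using assms by (simp add: stick_def)
qed

lemma stick_fun_upd:
  assumes "i < l" "l < N"
  shows "stick L (x(l := v)) N i = stick L x N i"
proof -
  have "(\<Prod>j=1..<i. (x(l := v)) j) = (\<Prod>j=1..<i. x j)"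
    using assms by (intro prod.cong) auto
  then show ?thesis
    using assms by (simp add: stick_def)
qed

lemma measurable_stick_PiM:
  assumes "1 \<le> i" "i \<le> N"
  shows "(\<lambda>x. stick L x N i) \<in> borel_measurable (Pi\<^sub>M {1..<N} (\<lambda>_. unif))"
proof (cases "i < N")
  case True
  have [measurable]: "(\<lambda>x. \<Prod>l=1..<i. x l) \<in> borel_measurable (Pi\<^sub>M {1..<N} (\<lambda>_. unif))"
    using assms by (intro borel_measurable_prod measurable_PiM_unif_component) auto
  show ?thesis
    using assms True measurable_PiM_unif_component[of i "{1..<N}"] by (simp add: stick_def)
next
  case False
  have [measurable]: "(\<lambda>x. \<Prod>l=1..<N. x l) \<in> borel_measurable (Pi\<^sub>M {1..<N} (\<lambda>_. unif))"
    by (intro borel_measurable_prod measurable_PiM_unif_component) auto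
  show ?thesis
    using False by (simp add: stick_def)
qed

text \<open>Integrating out the \<open>j - i - 1\<close> proportions between the sticks replaces the
  second factor by an iterated average, whose supremum norm has shrunk by 9/11 each time. The first
  factor is at most 1 in absolute value.\<close>

lemma sig_dev_covariance_PiM:
  assumes s: "s \<in> {1..<10}" and ij: "1 \<le> i" "i < j" "j \<le> N"
  shows "\<bar>\<integral>x. sig_dev s (stick L x N i) * sig_dev s (stick L x N j) \<partial>Pi\<^sub>M {1..<N} (\<lambda>_. unif)\<bar> \<le> (9/11) ^ (j - i - 1)"
    (is "\<bar>?I\<bar> \<le> _")
proof -
  let ?P = "Pi\<^sub>M {1..<N} (\<lambda>_. unif)"
  let ?h = "(cut_avg ^^ card {i<..<j}) (sig_dev s)"
  interpret P: prob_space ?P by (rule prob_space_PiM_unif)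
  \<comment> \<open>Everything in stick \<open>j\<close> except the proportions to be integrated
    out. The factor \<open>1 - x j\<close> may stay, as \<open>j\<close> lies outside
    \<open>{i<..<j}\<close>.\<close>
  define y where "y x = L * (\<Prod>l=1..i. x l) * (if j < N then 1 - x j else 1)" for x :: "nat \<Rightarrow> real"
  note g = benford_null_sig_dev[OF s]
  have h: "benford_null ((9/11) ^ (j - i - 1)) ?h"
    using cut_avg_iterate[OF g, of "card {i<..<j}"] by simp
  have [measurable]: "sig_dev s \<in> borel_measurable borel" "?h \<in> borel_measurable borel"
    by (rule benford_null_measurable[OF g] benford_null_measurable[OF h])+
  have z [measurable]: "(\<lambda>x. sig_dev s (stick L x N i)) \<in> borel_measurable ?P"
    by (rule measurable_compose[OF measurable_stick_PiM benford_null_measurable[OF g]]) (use ij in linarith)+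
  have [measurable]: "(\<lambda>x. \<Prod>l=1..i. x l) \<in> borel_measurable ?P"
    using ij by (intro borel_measurable_prod measurable_PiM_unif_component) auto
  have y [measurable]: "y \<in> borel_measurable ?P"
    unfolding y_def using ij measurable_PiM_unif_component[of j "{1..<N}"] by (cases "j < N") simp_all
  have "?I = (\<integral>x. sig_dev s (stick L x N i) * sig_dev s (y x * (\<Prod>l\<in>{i<..<j}. x l)) \<partial>?P)"
    unfolding y_def by (simp add: stick_split[OF ij])
  also have "\<dots> = (\<integral>x. sig_dev s (stick L x N i) * ?h (y x) \<partial>?P)"
  proof (rule integral_cut_avg_iterate[OF _ _ g z _ y])
    show "\<bar>sig_dev s (stick L x N i)\<bar> \<le> 1" for x
      by (rule benford_null_bound[OF g])
    show "sig_dev s (stick L (x(l := v)) N i) = sig_dev s (stick L x N i)" if "l \<in> {i<..<j}" for l x v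
      using that ij by (subst stick_fun_upd) auto
    show "y (x(l := v)) = y x" if "l \<in> {i<..<j}" for l x v
    proof -
      have "(\<Prod>k=1..i. (x(l := v)) k) = (\<Prod>k=1..i. x k)"
        using that by (intro prod.cong) auto
      then show ?thesis
        using that by (simp add: y_def)
    qed
  qed (use ij in auto)
  finally have eq: "?I = (\<integral>x. sig_dev s (stick L x N i) * ?h (y x) \<partial>?P)" .
  have B: "\<bar>sig_dev s (stick L x N i) * ?h (y x)\<bar> \<le> (9/11) ^ (j - i - 1)" for x
  proof -
    have "\<bar>sig_dev s (stick L x N i)\<bar> * \<bar>?h (y x)\<bar> \<le> 1 * (9/11) ^ (j - i - 1)"
      by (intro mult_mono benford_null_bound[OF g] benford_null_bound[OF h]) auto
    then show ?thesis by (simp add: abs_mult)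
  qed
  have int: "integrable ?P (\<lambda>x. sig_dev s (stick L x N i) * ?h (y x))"
  proof (rule P.integrable_const_bound)
    show "AE x in ?P. norm (sig_dev s (stick L x N i) * ?h (y x)) \<le> (9/11) ^ (j - i - 1)"
      unfolding real_norm_def using B by (rule AE_I2)
  qed measurable
  have "\<bar>?I\<bar> \<le> (\<integral>x. \<bar>sig_dev s (stick L x N i) * ?h (y x)\<bar> \<partial>?P)"
    unfolding eq by (rule integral_abs_bound)
  also have "\<dots> \<le> (9/11) ^ (j - i - 1)"
    by (intro P.integral_le_const integrable_abs int AE_I2 B)
  finally show ?thesis .
qed

section \<open>Summing the correlations, and the second moment\<close>

lemma sum_geometric_le:
  fixes r :: real
  assumes "0 \<le> r" "r < 1"
  shows "(\<Sum>i=1..n. r ^ (n - i)) \<le> 1 / (1 - r)"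
proof (induction n)
  case (Suc n)
  have "(\<Sum>i=1..Suc n. r ^ (Suc n - i)) = r * (\<Sum>i=1..n. r ^ (n - i)) + 1"
    by (simp add: sum_distrib_left Suc_diff_le)
  also have "\<dots> \<le> r * (1 / (1 - r)) + 1"
    using Suc assms by (intro add_right_mono mult_left_mono) auto
  also have "\<dots> = 1 / (1 - r)"
    using assms by (simp add: field_simps)
  finally show ?case .
qed (use assms in auto)

text \<open>Enlarging the matrix by one adds a diagonal entry and two equal borders, each dominated
  by a geometric series. The growth per step is bounded, so the sum is linear in \<open>n\<close>
  instead of quadratic.\<close>

lemma double_sum_geometric_le:
  fixes a :: "nat \<Rightarrow> nat \<Rightarrow> real" and r :: real
  assumes r: "0 \<le> r" "r < 1" and sym: "\<And>i j. a i j = a j i"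
    and diag: "\<And>i. 1 \<le> i \<Longrightarrow> i \<le> n \<Longrightarrow> a i i \<le> 1"
    and off: "\<And>i j. 1 \<le> i \<Longrightarrow> i < j \<Longrightarrow> j \<le> n \<Longrightarrow> a i j \<le> r ^ (j - i - 1)"
  shows "(\<Sum>i=1..n. \<Sum>j=1..n. a i j) \<le> (1 + 2 / (1 - r)) * real n"
  using diag off
proof (induction n)
  case (Suc n)
  have "(\<Sum>i=1..n. a i (Suc n)) \<le> (\<Sum>i=1..n. r ^ (n - i))"
  proof (rule sum_mono)
    fix i assume "i \<in> {1..n}"
    then show "a i (Suc n) \<le> r ^ (n - i)"
      using Suc.prems(2)[of i "Suc n"] by simp
  qed
  also have "\<dots> \<le> 1 / (1 - r)"
    by (rule sum_geometric_le[OF r])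
  finally have *: "(\<Sum>i=1..n. a i (Suc n)) \<le> 1 / (1 - r)" .
  have row: "(\<Sum>j=1..n. a (Suc n) j) = (\<Sum>i=1..n. a i (Suc n))"
    by (intro sum.cong refl sym)
  have "(\<Sum>i=1..Suc n. \<Sum>j=1..Suc n. a i j) =
      (\<Sum>i=1..n. \<Sum>j=1..n. a i j) + 2 * (\<Sum>i=1..n. a i (Suc n)) + a (Suc n) (Suc n)"
    using row by (simp add: sum.distrib)
  also have "\<dots> \<le> (1 + 2 / (1 - r)) * real n + 2 * (1 / (1 - r)) + 1"
    using Suc * by (intro add_mono mult_left_mono) auto
  also have "\<dots> = (1 + 2 / (1 - r)) * real (Suc n)"
    by (simp add: algebra_simps add_divide_distrib)
  finally show ?case .
qed simp

text \<open>The bias-variance decomposition: both terms on the right are nonnegative, so a bound on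
  the left controls each of them.\<close>

lemma (in prob_space) second_moment_about:
  fixes X :: "'a \<Rightarrow> real"
  assumes [measurable]: "random_variable borel X" and B: "\<And>\<omega>. \<bar>X \<omega>\<bar> \<le> B"
  shows "expectation (\<lambda>\<omega>. (X \<omega> - m)\<^sup>2) = variance X + (expectation X - m)\<^sup>2"
proof -
  have i1: "integrable M X"
    using B by (intro integrable_const_bound[where B=B]) auto
  have i2: "integrable M (\<lambda>\<omega>. (X \<omega>)\<^sup>2)"
  proof (intro integrable_const_bound[where B="B\<^sup>2"])
    show "AE \<omega> in M. norm ((X \<omega>)\<^sup>2) \<le> B\<^sup>2"
      using power_mono[OF B abs_ge_zero, of _ 2] by simp
  qed auto
  have "expectation (\<lambda>\<omega>. (X \<omega> - m)\<^sup>2) = expectation (\<lambda>\<omega>. (X \<omega>)\<^sup>2 - 2 * m * X \<omega> + m\<^sup>2)"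
    by (intro Bochner_Integration.integral_cong) (auto simp: power2_eq_square algebra_simps)
  also have "\<dots> = expectation (\<lambda>\<omega>. (X \<omega>)\<^sup>2) - 2 * m * expectation X + m\<^sup>2"
    using i1 i2 by (simp add: prob_space)
  finally have eq: "expectation (\<lambda>\<omega>. (X \<omega> - m)\<^sup>2) = expectation (\<lambda>\<omega>. (X \<omega>)\<^sup>2) - 2 * m * expectation X + m\<^sup>2" .
  show ?thesis
    unfolding variance_eq[OF i1 i2] eq by (simp add: power2_diff)
qed

section \<open>Transfer to the given probability space and passage to the limit\<close>

theorem theorem1p9:
  fixes M :: "'a measure" and p :: "nat \<Rightarrow> 'a \<Rightarrow> real" and L :: real
  assumes "prob_space M"
    and "L > 0"
    and "prob_space.indep_vars M (\<lambda>_. borel) p {1..}"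
    and "\<And>i. i \<ge> 1 \<Longrightarrow> distr M borel (p i) = uniform_measure lborel {0<..<1}"
  shows "\<forall>s\<in>{1..<10}.
      (\<lambda>N. prob_space.expectation M (\<lambda>\<omega>. sig_prop L (\<lambda>i. p i \<omega>) N s)) \<longlonglongrightarrow> log 10 s \<and>
      (\<lambda>N. prob_space.variance M (\<lambda>\<omega>. sig_prop L (\<lambda>i. p i \<omega>) N s)) \<longlonglongrightarrow> 0"
proof
  fix s :: real assume s: "s \<in> {1..<10}"
  interpret prob_space M by fact
  have p [measurable]: "p i \<in> borel_measurable M" if "i \<ge> 1" for i
    using assms(3) that unfolding indep_vars_def by auto
  have "AE u in unif. 0 < u \<and> u < 1"
    by (rule AE_uniform_measureI) auto
  then have "AE \<omega> in M. 0 < p i \<omega> \<and> p i \<omega> < 1" if "i \<ge> 1" for i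
    unfolding assms(4)[OF that, symmetric] by (rule AE_distrD[OF p[OF that]])
  \<comment> \<open>Almost surely all proportions lie in (0, 1), so all sticks are positive and
    \<open>sig_dev\<close> is the centred indicator on them.\<close>
  then have p01: "AE \<omega> in M. \<forall>i\<ge>1. 0 < p i \<omega> \<and> p i \<omega> < 1"
    by (simp add: AE_all_countable)
  have "(\<Prod>j=1..<i. p j \<omega>) > 0" if "\<forall>i\<ge>1. 0 < p i \<omega> \<and> p i \<omega> < 1" for i \<omega>
    using that by (intro prod_pos) auto
  then have stick_pos: "stick L (\<lambda>i. p i \<omega>) N i > 0"
    if "\<forall>i\<ge>1. 0 < p i \<omega> \<and> p i \<omega> < 1" "1 \<le> i" for N i \<omega>
    using that \<open>L > 0\<close> unfolding stick_def by auto
  have [measurable]: "(\<lambda>\<omega>. \<Prod>j=1..<i. p j \<omega>) \<in> borel_measurable M" for i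
    using p by (intro borel_measurable_prod) auto
  have [measurable]: "(\<lambda>\<omega>. stick L (\<lambda>i. p i \<omega>) N i) \<in> borel_measurable M" if "i \<ge> 1" for N i
    using that by (cases "i < N") (simp_all add: stick_def)
  note g = benford_null_sig_dev[OF s]
  have [measurable]: "sig_dev s \<in> borel_measurable borel" and dev: "\<bar>sig_dev s x\<bar> \<le> 1" for x
    using benford_null_measurable[OF g] benford_null_bound[OF g] by auto
  have dev2: "\<bar>sig_dev s x * sig_dev s x'\<bar> \<le> 1" for x x'
    unfolding abs_mult using dev by (intro mult_le_one) auto
  define m where "m = log 10 s"
  define X where "X N \<omega> = sig_prop L (\<lambda>i. p i \<omega>) N s" for N \<omega>
  define G where "G N i \<omega> = sig_dev s (stick L (\<lambda>i. p i \<omega>) N i)" for N i \<omega>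
  have [measurable]: "G N i \<in> borel_measurable M" if "i \<ge> 1" for N i
    unfolding G_def using that by measurable
  have G_int: "integrable M (\<lambda>\<omega>. G N i \<omega> * G N j \<omega>)" if "1 \<le> i" "1 \<le> j" for N i j
  proof (rule integrable_const_bound)
    show "AE \<omega> in M. norm (G N i \<omega> * G N j \<omega>) \<le> 1"
      unfolding real_norm_def G_def by (intro AE_I2 dev2)
  qed (use that in measurable)

  have cov: "expectation (\<lambda>\<omega>. G N i \<omega> * G N j \<omega>) \<le> (9/11) ^ (j - i - 1)"
    if ij: "1 \<le> i" "i < j" "j \<le> N" for N i j
  proof -
    let ?K = "{1..<N}"
    let ?P = "Pi\<^sub>M ?K (\<lambda>_. unif)"
    let ?F = "\<lambda>x. sig_dev s (stick L x N i) * sig_dev s (stick L x N j)"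
    have "indep_vars (\<lambda>_. borel) p ?K"
      using assms(3) by (rule indep_vars_subset) auto
    \<comment> \<open>Independence makes the joint law the product of the marginals. The criterion
      needs a nonempty index set, and \<open>ij\<close> gives N \<ge> 2.\<close>
    then have "distr M (\<Pi>\<^sub>M i\<in>?K. borel) (\<lambda>\<omega>. \<lambda>i\<in>?K. p i \<omega>) = (\<Pi>\<^sub>M i\<in>?K. distr M borel (p i))"
      using ij by (subst (asm) indep_vars_iff_distr_eq_PiM') auto
    also have "\<dots> = ?P"
      by (intro PiM_cong) (auto simp: assms(4))
    finally have distr: "distr M (\<Pi>\<^sub>M i\<in>?K. borel) (\<lambda>\<omega>. \<lambda>i\<in>?K. p i \<omega>) = ?P" .
    have sets: "sets ?P = sets (\<Pi>\<^sub>M i\<in>?K. borel)"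
      by (rule sets_PiM_cong) auto
    have "?F \<in> borel_measurable ?P"
      by (intro borel_measurable_times;
          rule measurable_compose[OF measurable_stick_PiM benford_null_measurable[OF g]])
         (use ij in linarith)+
    then have F: "?F \<in> borel_measurable (\<Pi>\<^sub>M i\<in>?K. borel)"
      by (simp cong: measurable_cong_sets add: sets)
    have "expectation (\<lambda>\<omega>. G N i \<omega> * G N j \<omega>) = expectation (\<lambda>\<omega>. ?F (\<lambda>i\<in>?K. p i \<omega>))"
    proof (intro Bochner_Integration.integral_cong refl)
      fix \<omega>
      have "stick L (\<lambda>i. p i \<omega>) N k = stick L (\<lambda>i\<in>?K. p i \<omega>) N k" if "1 \<le> k" "k \<le> N" for k
        using that by (intro stick_cong) auto
      then show "G N i \<omega> * G N j \<omega> = ?F (\<lambda>i\<in>?K. p i \<omega>)"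
        using ij by (simp add: G_def)
    qed
    also have "\<dots> = (\<integral>x. ?F x \<partial>?P)"
      unfolding distr[symmetric] using F
      by (intro integral_distr[symmetric] measurable_restrict) auto
    also have "\<dots> \<le> (9/11) ^ (j - i - 1)"
      using sig_dev_covariance_PiM[OF s ij, of L] by linarith
    finally show ?thesis .
  qed

  have moment: "expectation (\<lambda>\<omega>. (X N \<omega> - m)\<^sup>2) \<le> 12 / real N" if N: "N \<ge> 1" for N
  proof -
    \<comment> \<open>Only almost everywhere, because replacing the centred indicators by
      \<open>sig_dev\<close> requires positive sticks.\<close>
    have "AE \<omega> in M. (X N \<omega> - m)\<^sup>2 = (1 / real N)\<^sup>2 * (\<Sum>i=1..N. \<Sum>j=1..N. G N i \<omega> * G N j \<omega>)"
      using p01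
    proof eventually_elim
      case (elim \<omega>)
      have "(\<Sum>i=1..N. G N i \<omega>) = (\<Sum>i=1..N. sig_ind s (stick L (\<lambda>i. p i \<omega>) N i) - m)"
        using stick_pos[OF elim] by (intro sum.cong) (auto simp: G_def sig_dev_def m_def)
      then have "X N \<omega> - m = 1 / real N * (\<Sum>i=1..N. G N i \<omega>)"
        using N by (simp add: X_def sig_prop_def sum_subtractf field_simps)
      then show ?case
        by (simp add: power_mult_distrib power2_eq_square sum_product)
    qed
    then have "expectation (\<lambda>\<omega>. (X N \<omega> - m)\<^sup>2) =
        expectation (\<lambda>\<omega>. (1 / real N)\<^sup>2 * (\<Sum>i=1..N. \<Sum>j=1..N. G N i \<omega> * G N j \<omega>))"
      by (intro integral_cong_AE) (auto simp: X_def sig_prop_def)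
    also have "\<dots> = (1 / real N)\<^sup>2 * (\<Sum>i=1..N. \<Sum>j=1..N. expectation (\<lambda>\<omega>. G N i \<omega> * G N j \<omega>))"
    proof -
      have "expectation (\<lambda>\<omega>. \<Sum>j=1..N. G N i \<omega> * G N j \<omega>) = (\<Sum>j=1..N. expectation (\<lambda>\<omega>. G N i \<omega> * G N j \<omega>))"
        if "i \<in> {1..N}" for i
        using that by (intro Bochner_Integration.integral_sum G_int) auto
      moreover have "expectation (\<lambda>\<omega>. \<Sum>i=1..N. \<Sum>j=1..N. G N i \<omega> * G N j \<omega>) =
          (\<Sum>i=1..N. expectation (\<lambda>\<omega>. \<Sum>j=1..N. G N i \<omega> * G N j \<omega>))"
        by (intro Bochner_Integration.integral_sum Bochner_Integration.integrable_sum G_int) auto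
      ultimately show ?thesis
        by simp
    qed
    \<comment> \<open>The constant is 1 + 2 / (1 - 9/11) = 12; one factor 1/N survives.\<close>
    also have "\<dots> \<le> (1 / real N)\<^sup>2 * ((1 + 2 / (1 - 9/11)) * real N)"
    proof (intro mult_left_mono double_sum_geometric_le cov)
      show "expectation (\<lambda>\<omega>. G N i \<omega> * G N i \<omega>) \<le> 1" if "1 \<le> i" for i
      proof (rule integral_le_const[OF G_int])
        show "AE \<omega> in M. G N i \<omega> * G N i \<omega> \<le> 1"
          unfolding G_def by (intro AE_I2 abs_le_D1[OF dev2])
      qed (use that in auto)
    qed (auto simp: mult.commute)
    also have "\<dots> = 12 / real N"
      using N by (simp add: power2_eq_square)
    finally show ?thesis .
  qed

  have X01: "\<bar>X N \<omega>\<bar> \<le> 1" for N \<omega>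
  proof -
    have "(\<Sum>i=1..N. sig_ind s (stick L (\<lambda>i. p i \<omega>) N i)) \<le> (\<Sum>i=1..N. 1)"
      "(\<Sum>i=1..N. sig_ind s (stick L (\<lambda>i. p i \<omega>) N i)) \<ge> 0"
      by (intro sum_mono sum_nonneg; simp add: sig_ind_def)+
    then show ?thesis
      by (cases "N = 0") (auto simp: X_def sig_prop_def field_simps)
  qed
  have X: "X N \<in> borel_measurable M" for N
    unfolding X_def[abs_def] sig_prop_def by auto
  have split: "expectation (\<lambda>\<omega>. (X N \<omega> - m)\<^sup>2) = variance (X N) + (expectation (X N) - m)\<^sup>2" for N
    by (rule second_moment_about[OF X X01])
  have lim: "(\<lambda>N. 12 / real N) \<longlonglongrightarrow> 0"
    by (rule lim_const_over_n)
  have var: "(\<lambda>N. variance (X N)) \<longlonglongrightarrow> 0"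
  proof (rule tendsto_sandwich[OF _ _ tendsto_const lim])
    show "\<forall>\<^sub>F N in sequentially. variance (X N) \<le> 12 / real N"
      using eventually_ge_at_top[of 1]
    proof eventually_elim
      case (elim N)
      then show ?case
        using moment[of N] split[of N] zero_le_power2[of "expectation (X N) - m"] by linarith
    qed
  qed (simp add: variance_positive)
  have "(\<lambda>N. (expectation (X N) - m)\<^sup>2) \<longlonglongrightarrow> 0"
  proof (rule tendsto_sandwich[OF _ _ tendsto_const lim])
    show "\<forall>\<^sub>F N in sequentially. (expectation (X N) - m)\<^sup>2 \<le> 12 / real N"
      using eventually_ge_at_top[of 1]
    proof eventually_elim
      case (elim N)
      then show ?case
        using moment[of N] split[of N] variance_positive[of "X N"] by linarith
    qed
  qed simp
  \<comment> \<open>The root of the squared bias is its absolute value, which therefore tends to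
    0.\<close>
  then have "(\<lambda>N. sqrt ((expectation (X N) - m)\<^sup>2)) \<longlonglongrightarrow> sqrt 0"
    by (rule tendsto_real_sqrt)
  then have "(\<lambda>N. expectation (X N)) \<longlonglongrightarrow> m"
    by (simp add: tendsto_rabs_zero_iff LIM_zero_iff)
  with var show "(\<lambda>N. expectation (\<lambda>\<omega>. sig_prop L (\<lambda>i. p i \<omega>) N s)) \<longlonglongrightarrow> log 10 s \<and>
      (\<lambda>N. variance (\<lambda>\<omega>. sig_prop L (\<lambda>i. p i \<omega>) N s)) \<longlonglongrightarrow> 0"
    unfolding X_def[abs_def] m_def by blast
qed

end
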